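(* Let $\mathcal{H}$ be a complex Hilbert space and $T:\mathcal{H}\to\mathcal{H}$ a bounded linear operator. Suppose there exists a bounded linear operator $S$ on $\mathcal{H}$ such that $S^2\neq 0$, $TS=ST$ and $T^*T\geq S^*S+I$. Then $T$ is not $1$-weakly hypercyclic.
   Context: For self-adjoint operators, $A\geq B$ means $\langle (A-B)x,x\rangle\geq 0$ for all $x\in\mathcal{H}$; $T^*$ is the Hilbert space adjoint. For $n\in\mathbb{N}$, a bounded operator $T$ on a Banach space $X$ over $\mathbb{K}$ is $n$-weakly hypercyclic if there is $x\in X$ such that for every continuous surjective linear map $L:X\to\mathbb{K}^n$, the set $\{L(T^mx):m\in\mathbb{Z}_+\}$ is dense in $\mathbb{K}^n$. *)

theory Defs
  imports "HOL-Analysis.Analysis"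
begin

class complex_vector = real_vector +
  fixes scaleC :: "complex \<Rightarrow> 'a \<Rightarrow> 'a" (infixr "*\<^sub>C" 75)
  assumes scaleC_add_right: "a *\<^sub>C (x + y) = a *\<^sub>C x + a *\<^sub>C y"
    and scaleC_add_left: "(a + b) *\<^sub>C x = a *\<^sub>C x + b *\<^sub>C x"
    and scaleC_scaleC: "a *\<^sub>C (b *\<^sub>C x) = (a * b) *\<^sub>C x"
    and scaleC_one: "1 *\<^sub>C x = x"
    and scaleR_scaleC: "scaleR r x = (complex_of_real r) *\<^sub>C x"

class complex_inner = complex_vector + real_normed_vector +
  fixes cinner :: "'a \<Rightarrow> 'a \<Rightarrow> complex"
  assumes cinner_commute: "cinner x y = cnj (cinner y x)"
    and cinner_add_left: "cinner (x + y) z = cinner x z + cinner y z"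
    and cinner_scaleC_left: "cinner (r *\<^sub>C x) y = cnj r * cinner x y"
    and cinner_ge_zero: "0 \<le> Re (cinner x x)"
    and cinner_eq_zero_iff: "cinner x x = 0 \<longleftrightarrow> x = 0"
    and norm_eq_sqrt_cinner: "norm x = sqrt (Re (cinner x x))"

class chilbert_space = complex_inner + complete_space

definition clinear :: "('a::complex_vector \<Rightarrow> 'b::complex_vector) \<Rightarrow> bool" where
  "clinear f \<longleftrightarrow> (\<forall>x y. f (x + y) = f x + f y) \<and> (\<forall>c x. f (c *\<^sub>C x) = c *\<^sub>C f x)"

definition bounded_clinear_op :: "('a::complex_inner \<Rightarrow> 'b::complex_inner) \<Rightarrow> bool" where
  "bounded_clinear_op f \<longleftrightarrow> clinear f \<and> (\<exists>K. \<forall>x. norm (f x) \<le> norm x * K)"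

definition cadjoint :: "('a::complex_inner \<Rightarrow> 'a) \<Rightarrow> ('a \<Rightarrow> 'a)" where
  "cadjoint T = (SOME T'. \<forall>x y. cinner (T x) y = cinner x (T' y))"

definition op_le :: "('a::complex_inner \<Rightarrow> 'a) \<Rightarrow> ('a \<Rightarrow> 'a) \<Rightarrow> bool" where
  "op_le A B \<longleftrightarrow> (\<forall>x. Im (cinner ((B x - A x)) x) = 0 \<and> Re (cinner ((B x - A x)) x) \<ge> 0)"

text \<open>\<complex>^n is represented as the functions nat \<Rightarrow> complex vanishing from index n on,
  carrying the (product) topology of the function space.\<close>
definition Cn :: "nat \<Rightarrow> (nat \<Rightarrow> complex) set" where
  "Cn n = {v. \<forall>i\<ge>n. v i = 0}"

definition n_weakly_hypercyclic ::
    "nat \<Rightarrow> ('a::{complex_vector, topological_space} \<Rightarrow> 'a) \<Rightarrow> bool" where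
  "n_weakly_hypercyclic n T \<longleftrightarrow>
     (\<exists>x. \<forall>L :: 'a \<Rightarrow> (nat \<Rightarrow> complex).
        ((\<forall>u v. L (u + v) = (\<lambda>i. L u i + L v i)) \<and> (\<forall>c u. L (c *\<^sub>C u) = (\<lambda>i. c * L u i))
         \<and> continuous_on UNIV L \<and> L ` UNIV = Cn n)
        \<longrightarrow> closure ((\<lambda>m. L ((T ^^ m) x)) ` UNIV) \<supseteq> Cn n)"

end

theory Submission
  imports Defs
begin

text \<open>
  The hypothesis says \<open>\<parallel>Tu\<parallel>\<^sup>2 \<ge> \<parallel>u\<parallel>\<^sup>2 + \<parallel>Su\<parallel>\<^sup>2\<close>. Iterating it along the orbits of
  \<open>S\<^sup>2x\<close>, \<open>Sx\<close> and \<open>x\<close> in turn makes \<open>\<parallel>T\<^sup>nx\<parallel>\<^sup>2\<close> grow quadratically when \<open>S\<^sup>2x \<noteq> 0\<close>, so that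
  \<open>\<Sum>\<^sub>n \<parallel>T\<^sup>nx\<parallel>\<^sup>-\<^sup>2 < \<infinity>\<close>. A weak form of Ball's complex plank theorem then provides a vector \<open>y\<close>
  with \<open>|\<langle>T\<^sup>nx, y\<rangle>|\<close> bounded away from 0. If \<open>S\<^sup>2x = 0\<close>, a nonzero vector in the range of
  \<open>(S\<^sup>*)\<^sup>2\<close> is orthogonal to the whole orbit.

  The plank theorem is proved by almost maximising \<open>\<Prod>\<^sub>i |\<langle>v\<^sub>i, z\<rangle>|\<close>, with exponents \<open>p\<^sub>i\<close>, over unit
  vectors \<open>z\<close>. Comparing \<open>z\<close> with \<open>z + \<lambda>v\<^sub>j\<close> and averaging logarithms over the circle
  \<open>|\<lambda>| = r\<close>, Jensen's formula shows that all factors contribute nonnegatively, and the \<open>j\<close>-th one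
  at least \<open>p\<^sub>j ln (r\<parallel>v\<^sub>j\<parallel>\<^sup>2 / |\<langle>v\<^sub>j, z\<rangle>|)\<close>, while the norm costs at most \<open>r\<^sup>2\<parallel>v\<^sub>j\<parallel>\<^sup>2 / 2\<close>.
  Taking \<open>r\<^sup>2\<parallel>v\<^sub>j\<parallel>\<^sup>2\<close> of order \<open>p\<^sub>j\<close> bounds \<open>|\<langle>v\<^sub>j, z\<rangle>|\<close> from below. Weak compactness passes to
  infinitely many vectors.
\<close>

section \<open>Hilbert space preliminaries\<close>

lemma cinner_add_right: "cinner x (y + z) = cinner x y + cinner x z"
  for x :: "'a::complex_inner"
  by (metis cinner_add_left cinner_commute complex_cnj_add)

lemma cinner_scaleC_right: "cinner x (r *\<^sub>C y) = r * cinner x y"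
  for x :: "'a::complex_inner"
  by (metis cinner_commute cinner_scaleC_left complex_cnj_cnj complex_cnj_mult)

lemma cinner_scaleR_left: "cinner (r *\<^sub>R x) y = of_real r * cinner x y"
  for x :: "'a::complex_inner"
  by (simp add: scaleR_scaleC cinner_scaleC_left)

lemma cinner_scaleR_right: "cinner x (r *\<^sub>R y) = of_real r * cinner x y"
  for x :: "'a::complex_inner"
  by (simp add: scaleR_scaleC cinner_scaleC_right)

lemma cinner_minus_left: "cinner (- x) y = - cinner x y"
  for x :: "'a::complex_inner"
  using cinner_scaleR_left[of "-1" x y] by simp

lemma cinner_minus_right: "cinner x (- y) = - cinner x y"
  for x :: "'a::complex_inner"
  using cinner_scaleR_right[of x "-1" y] by simp

lemma cinner_diff_left: "cinner (x - y) z = cinner x z - cinner y z"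
  for x :: "'a::complex_inner"
  using cinner_add_left[of x "- y" z] by (simp add: cinner_minus_left)

lemma cinner_diff_right: "cinner x (y - z) = cinner x y - cinner x z"
  for x :: "'a::complex_inner"
  using cinner_add_right[of x y "- z"] by (simp add: cinner_minus_right)

lemma cinner_zero_left [simp]: "cinner 0 y = 0"
  for y :: "'a::complex_inner"
  using cinner_scaleR_left[of 0 0 y] by simp

lemma cinner_zero_right [simp]: "cinner y 0 = 0"
  for y :: "'a::complex_inner"
  using cinner_scaleR_right[of y 0 0] by simp

lemma cinner_self: "cinner x x = of_real ((norm x)\<^sup>2)"
  for x :: "'a::complex_inner"
proof (rule complex_eqI)
  have "Im (cinner x x) = - Im (cinner x x)"
    using arg_cong[OF cinner_commute[of x x], of Im] by simp
  thus "Im (cinner x x) = Im (of_real ((norm x)\<^sup>2))" by simp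
  show "Re (cinner x x) = Re (of_real ((norm x)\<^sup>2))"
    by (simp add: norm_eq_sqrt_cinner cinner_ge_zero)
qed

section \<open>Norm expansions, projections and the Cauchy-Schwarz inequality\<close>

lemma norm_add_scaleC_square:
  "(norm (x + c *\<^sub>C y))\<^sup>2 = (norm x)\<^sup>2 + 2 * Re (c * cinner x y) + (cmod c)\<^sup>2 * (norm y)\<^sup>2"
  for x :: "'a::complex_inner"
proof -
  have "complex_of_real ((norm (x + c *\<^sub>C y))\<^sup>2) =
     cinner x x + (c * cinner x y + cnj (c * cinner x y)) + (c * cnj c) * cinner y y"
    unfolding cinner_self[symmetric]
    using cinner_commute[of y x]
    by (simp add: cinner_add_left cinner_add_right cinner_scaleC_left cinner_scaleC_right algebra_simps)
  also have "\<dots> = of_real ((norm x)\<^sup>2 + 2 * Re (c * cinner x y) + (cmod c)\<^sup>2 * (norm y)\<^sup>2)"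
    unfolding cinner_self complex_add_cnj complex_norm_square[symmetric] by simp
  finally show ?thesis using of_real_eq_iff by blast
qed

text \<open>The coefficient subtracts the orthogonal projection of \<open>x\<close> onto
  \<open>y\<close>; it is conjugated because \<open>cinner\<close> is conjugate-linear in its first
  argument. Nonnegativity of the left side yields Cauchy-Schwarz, and minimality of a norm yields
  orthogonality in the Riesz theorem.\<close>

lemma norm_minus_projection_square:
  fixes x :: "'a::complex_inner"
  assumes "y \<noteq> 0"
  shows "(norm (x + (- cnj (cinner x y) / of_real ((norm y)\<^sup>2)) *\<^sub>C y))\<^sup>2 =
    (norm x)\<^sup>2 - (cmod (cinner x y))\<^sup>2 / (norm y)\<^sup>2"
proof -
  define c where "c = - cnj (cinner x y) / of_real ((norm y)\<^sup>2)"
  have "c * cinner x y = of_real (- ((cmod (cinner x y))\<^sup>2 / (norm y)\<^sup>2))"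
    unfolding c_def of_real_minus of_real_divide complex_norm_square by (simp add: mult.commute)
  hence 1: "Re (c * cinner x y) = - ((cmod (cinner x y))\<^sup>2 / (norm y)\<^sup>2)"
    by (metis Re_complex_of_real)
  have 2: "(cmod c)\<^sup>2 * (norm y)\<^sup>2 = (cmod (cinner x y))\<^sup>2 / (norm y)\<^sup>2"
    using assms unfolding c_def
    by (simp add: norm_divide power_divide norm_mult norm_power power2_eq_square)
  show ?thesis
    using norm_add_scaleC_square[of x c y] 1 2 unfolding c_def by linarith
qed

lemma norm_cinner_le: "norm (cinner x y) \<le> norm x * norm y"
  for x :: "'a::complex_inner"
proof (cases "y = 0")
  case False
  have "0 \<le> (norm x)\<^sup>2 - (cmod (cinner x y))\<^sup>2 / (norm y)\<^sup>2"
    unfolding norm_minus_projection_square[OF False, symmetric] by simp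
  hence "(cmod (cinner x y))\<^sup>2 \<le> (norm x * norm y)\<^sup>2"
    using False by (simp add: field_simps power_mult_distrib)
  thus ?thesis by (rule power2_le_imp_le) simp
qed simp

lemma bounded_linear_cinner_right: "bounded_linear (cinner x)"
  for x :: "'a::complex_inner"
  by (rule bounded_linear_intro[where K = "norm x"])
     (simp_all add: cinner_add_right cinner_scaleR_right scaleR_conv_of_real norm_cinner_le
        mult.commute[of "norm _" "norm x"])

lemma parallelogram_law:
  "(norm (x + y))\<^sup>2 + (norm (x - y))\<^sup>2 = 2 * (norm x)\<^sup>2 + 2 * (norm y)\<^sup>2"
  for x :: "'a::complex_inner"
proof -
  have "x + 1 *\<^sub>C y = x + y" "x + (-1) *\<^sub>C y = x - y"
    using scaleR_scaleC[of "-1" y] by (simp_all add: scaleC_one)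
  thus ?thesis
    using norm_add_scaleC_square[of x 1 y] norm_add_scaleC_square[of x "-1" y] by simp
qed

section \<open>Minimal-norm arguments: nested convex sets, Riesz representation, adjoints\<close>

text \<open>This takes the place of weak compactness of balls. Points of nearly minimal norm in
  \<open>K m\<close> form a Cauchy sequence by the parallelogram law, since midpoints stay in the
  convex sets; the bound \<open>B\<close> makes the minimal norms converge.\<close>

lemma nested_closed_convex_nonempty:
  fixes K :: "nat \<Rightarrow> 'a::chilbert_space set"
  assumes closed: "\<And>m. closed (K m)" and convex: "\<And>m. convex (K m)"
    and dec: "\<And>m n. m \<le> n \<Longrightarrow> K n \<subseteq> K m"
    and bd: "\<And>m. \<exists>x\<in>K m. norm x \<le> B"
  shows "\<exists>x. \<forall>m. x \<in> K m"
proof -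
  have ne: "K m \<noteq> {}" for m using bd[of m] by blast
  define d where "d m = (INF x\<in>K m. norm x)" for m
  have bb: "bdd_below (norm ` K m)" for m by (rule bdd_belowI[of _ 0]) auto
  have d_le: "d m \<le> norm x" if "x \<in> K m" for m x
    unfolding d_def using bb that by (rule cINF_lower)
  have d0: "0 \<le> d m" for m
    unfolding d_def using ne by (intro cINF_greatest) auto
  have d_mono: "d m \<le> d n" if "m \<le> n" for m n
    unfolding d_def using ne bb dec[OF that] by (intro cINF_superset_mono) auto
  have dB: "d m \<le> B" for m using bd[of m] d_le by force
  obtain l where l: "d \<longlonglongrightarrow> l" and dl: "\<And>m. d m \<le> l"
    using incseq_convergent[of d B] d_mono dB by (auto simp: incseq_def)
  define e where "e m = inverse (real (Suc m))" for m
  have "\<exists>x\<in>K m. norm x < d m + e m" for m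
    using cINF_less_iff[OF ne[of m] bb[of m], of "d m + e m"] unfolding d_def e_def
    by (simp add: less_add_same_cancel1)
  then obtain y where y: "\<And>m. y m \<in> K m" "\<And>m. norm (y m) < d m + e m"
    by metis
  \<comment> \<open>For \<open>n \<ge> m\<close> both \<open>y m\<close> and \<open>y n\<close> lie
    in \<open>K m\<close>, so their midpoint has norm at least \<open>d m\<close>;
    \<open>g m\<close> is what the parallelogram law then leaves for the squared distance.\<close>
  define g where "g m = 2 * (d m + e m)\<^sup>2 + 2 * (l + e m)\<^sup>2 - 4 * (d m)\<^sup>2" for m
  have e: "e \<longlonglongrightarrow> 0" unfolding e_def by (rule LIMSEQ_inverse_real_of_nat)
  have "g \<longlonglongrightarrow> 2 * (l + 0)\<^sup>2 + 2 * (l + 0)\<^sup>2 - 4 * l\<^sup>2"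
    unfolding g_def by (intro tendsto_intros l e)
  hence g: "g \<longlonglongrightarrow> 0" by simp
  have dist: "(norm (y m - y n))\<^sup>2 \<le> g m" if "m \<le> n" for m n
  proof -
    have "(1/2) *\<^sub>R y m + (1/2) *\<^sub>R y n \<in> K m"
      using y dec[OF that] convex[of m] by (intro convexD) auto
    from d_le[OF this] have "d m \<le> norm (y m + y n) / 2"
      by (simp flip: scaleR_add_right)
    hence "(d m)\<^sup>2 \<le> (norm (y m + y n) / 2)\<^sup>2" using d0 by (intro power_mono) auto
    moreover have "(norm (y m))\<^sup>2 \<le> (d m + e m)\<^sup>2" using y(2)[of m] by (intro power_mono) auto
    moreover have "e n \<le> e m" using that unfolding e_def by (simp add: field_simps)
    hence "(norm (y n))\<^sup>2 \<le> (l + e m)\<^sup>2" using y(2)[of n] dl[of n] by (intro power_mono) auto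
    ultimately show ?thesis
      using parallelogram_law[of "y m" "y n"] unfolding g_def by (simp add: power_divide)
  qed
  have "Cauchy y"
  proof (rule metric_CauchyI)
    fix r :: real assume r: "r > 0"
    hence "r\<^sup>2 > 0" by simp
    then obtain M where M: "\<And>m. m \<ge> M \<Longrightarrow> g m < r\<^sup>2"
      using order_tendstoD(2)[OF g] unfolding eventually_sequentially by meson
    have *: "dist (y m) (y n) < r" if "m \<ge> M" "m \<le> n" for m n
    proof -
      have "(norm (y m - y n))\<^sup>2 < r\<^sup>2" using dist[OF that(2)] M[OF that(1)] by linarith
      thus ?thesis using r by (simp add: dist_norm power2_less_imp_less)
    qed
    show "\<exists>M. \<forall>m\<ge>M. \<forall>n\<ge>M. dist (y m) (y n) < r"
      using * by (metis dist_commute nle_le)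
  qed
  then obtain x where x: "y \<longlonglongrightarrow> x" using Cauchy_convergent_iff convergent_def by blast
  have "x \<in> K m" for m
  proof (rule Lim_in_closed_set[OF closed _ _ x])
    show "\<forall>\<^sub>F n in sequentially. y n \<in> K m"
      unfolding eventually_sequentially using y(1) dec by blast
  qed simp
  thus ?thesis by blast
qed

text \<open>The point \<open>y\<close> of least norm on the affine hyperplane \<open>f = 1\<close>
  is orthogonal to the kernel of \<open>f\<close>, so \<open>f\<close> is a multiple of
  \<open>cinner y\<close>. Such a point exists by intersecting the hyperplane with closed balls
  shrinking to the minimal radius.\<close>

lemma riesz_representation:
  fixes f :: "'a::chilbert_space \<Rightarrow> complex"
  assumes add: "\<And>x y. f (x + y) = f x + f y" and scale: "\<And>c x. f (c *\<^sub>C x) = c * f x"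
    and bd: "\<And>x. norm (f x) \<le> norm x * B"
  shows "\<exists>y. \<forall>x. f x = cinner y x"
proof (cases "\<forall>x. f x = 0")
  case True
  thus ?thesis by (intro exI[of _ 0]) simp
next
  case False
  then obtain x0 where x0: "f x0 \<noteq> 0" by blast
  interpret f: bounded_linear f
    by (rule bounded_linear_intro[where K = B])
       (simp_all add: add scaleR_scaleC scale bd scaleR_conv_of_real)
  define A where "A = {x. f x = 1}"
  have Ane: "A \<noteq> {}"
    using x0 scale[of "1 / f x0" x0] unfolding A_def by auto
  define d where "d = (INF x\<in>A. norm x)"
  have bb: "bdd_below (norm ` A)" by (rule bdd_belowI[of _ 0]) auto
  have d_le: "d \<le> norm x" if "x \<in> A" for x
    unfolding d_def using bb that by (rule cINF_lower)
  define K where "K m = A \<inter> cball 0 (d + inverse (real (Suc m)))" for m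
  have clA: "closed A" unfolding A_def
    by (intro closed_Collect_eq continuous_intros f.continuous_on)
  have convA: "convex A" unfolding A_def
    by (rule convexI) (auto simp: f.add f.scaleR scaleR_conv_of_real simp flip: of_real_add)
  have Kne: "K m \<noteq> {}" for m
  proof -
    have "\<exists>x\<in>A. norm x < d + inverse (real (Suc m))"
      using cINF_less_iff[OF Ane bb, of "d + inverse (real (Suc m))"] unfolding d_def
      by (simp add: less_add_same_cancel1)
    thus ?thesis unfolding K_def by (force simp: less_imp_le)
  qed
  have "\<exists>y. \<forall>m. y \<in> K m"
  proof (rule nested_closed_convex_nonempty[where B = "d + 1"])
    show "closed (K m)" "convex (K m)" for m
      unfolding K_def using clA convA by (auto intro!: convex_Int)
    show "K n \<subseteq> K m" if "m \<le> n" for m n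
    proof -
      have "inverse (real (Suc n)) \<le> inverse (real (Suc m))" using that by (simp add: field_simps)
      thus ?thesis unfolding K_def by (intro Int_mono subset_cball) auto
    qed
    show "\<exists>x\<in>K m. norm x \<le> d + 1" for m
    proof -
      obtain x where "x \<in> K m" using Kne by blast
      moreover have "inverse (real (Suc m)) \<le> 1" by (simp add: field_simps)
      ultimately show ?thesis unfolding K_def by force
    qed
  qed
  then obtain y where y: "\<And>m. y \<in> K m" by blast
  have fy: "f y = 1" using y[of 0] unfolding K_def A_def by simp
  have "norm y \<le> d"
  proof (rule LIMSEQ_le_const)
    show "(\<lambda>m. d + inverse (real (Suc m))) \<longlonglongrightarrow> d"
      using tendsto_add[OF tendsto_const[of d] LIMSEQ_inverse_real_of_nat] by simp
    show "\<exists>N. \<forall>m\<ge>N. norm y \<le> d + inverse (real (Suc m))"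
      using y unfolding K_def by auto
  qed
  have y0: "y \<noteq> 0" using fy f.zero by auto
  have orth: "cinner y h = 0" if h: "f h = 0" for h
  proof (cases "h = 0")
    case False
    define c where "c = - cnj (cinner y h) / of_real ((norm h)\<^sup>2)"
    have "y + c *\<^sub>C h \<in> A" unfolding A_def by (simp add: f.add scale h fy)
    hence "norm y \<le> norm (y + c *\<^sub>C h)" using d_le \<open>norm y \<le> d\<close> by fastforce
    hence "(norm y)\<^sup>2 \<le> (norm (y + c *\<^sub>C h))\<^sup>2" by (intro power_mono) auto
    hence "(cmod (cinner y h))\<^sup>2 / (norm h)\<^sup>2 \<le> 0"
      using norm_minus_projection_square[OF False, of y] unfolding c_def by linarith
    thus ?thesis using False by (simp add: divide_le_0_iff)
  qed simp
  show ?thesis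
  proof (intro exI allI)
    fix x
    have "f (x - f x *\<^sub>C y) = 0" by (simp add: f.diff scale fy)
    from orth[OF this] have "cinner y x = f x * of_real ((norm y)\<^sup>2)"
      by (simp add: cinner_diff_right cinner_scaleC_right cinner_self)
    thus "f x = cinner ((1 / of_real ((norm y)\<^sup>2)) *\<^sub>C y) x"
      using y0 by (simp add: cinner_scaleC_left)
  qed
qed

text \<open>\<open>cadjoint\<close> is obtained by choice, so its identity holds only once some
  adjoint exists; Riesz supplies one, applied for each \<open>y\<close> to the functional sending
  \<open>x\<close> to \<open>cinner y (T x)\<close>.\<close>

lemma cinner_cadjoint:
  fixes T :: "'a::chilbert_space \<Rightarrow> 'a"
  assumes "bounded_clinear_op T"
  shows "cinner (T x) y = cinner x (cadjoint T y)"
proof -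
  from assms obtain B where add: "\<And>x y. T (x + y) = T x + T y"
    and scale: "\<And>c x. T (c *\<^sub>C x) = c *\<^sub>C T x" and bd: "\<And>x. norm (T x) \<le> norm x * B"
    unfolding bounded_clinear_op_def clinear_def by blast
  have "\<exists>z. \<forall>x. cinner y (T x) = cinner z x" for y
  proof (rule riesz_representation)
    show "norm (cinner y (T x)) \<le> norm x * (norm y * B)" for x
      using norm_cinner_le[of y "T x"] mult_left_mono[OF bd[of x], of "norm y"]
      by (simp add: mult_ac)
  qed (simp_all add: add scale cinner_add_right cinner_scaleC_right)
  then obtain T' where "\<And>y x. cinner y (T x) = cinner (T' y) x" by metis
  hence "\<exists>T'. \<forall>x y. cinner (T x) y = cinner x (T' y)"
    by (metis cinner_commute)
  from someI_ex[OF this] show ?thesis unfolding cadjoint_def by blast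
qed

section \<open>A complex plank theorem\<close>

text \<open>Orders that are powers of two allow an induction: the roots pair up as
  \<open>\<zeta>\<close> and \<open>- \<zeta>\<close>, and each pair of factors multiplies to
  \<open>1 - \<zeta>^2 * x^2\<close>. These orders suffice, as only a limit along growing orders is
  taken.\<close>

lemma prod_roots_of_unity:
  "(\<Prod>k<2 ^ s. 1 - cis (2 * pi * real k / 2 ^ s) * x) = 1 - x ^ (2 ^ s)"
proof (induction s arbitrary: x)
  case 0
  show ?case by simp
next
  case (Suc s)
  define m :: nat where "m = 2 ^ s"
  have m: "real m = 2 ^ s" "m > 0" unfolding m_def by simp_all
  define \<zeta> where "\<zeta> k = cis (2 * pi * real k / 2 ^ Suc s)" for k
  have shift: "\<zeta> (k + m) = - \<zeta> k" for k
  proof -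
    have "2 * pi * real (k + m) / 2 ^ Suc s = 2 * pi * real k / 2 ^ Suc s + pi"
      using m by (simp add: field_simps)
    thus ?thesis unfolding \<zeta>_def by (simp flip: cis_mult)
  qed
  have square: "\<zeta> k * \<zeta> k = cis (2 * pi * real k / 2 ^ s)" for k
    unfolding \<zeta>_def cis_mult by (simp add: field_simps)
  have "{..<2 ^ Suc s} = {..<m} \<union> (\<lambda>k. k + m) ` {..<m}"
    unfolding m_def lessThan_atLeast0 image_add_atLeastLessThan' by auto
  hence "(\<Prod>k<2 ^ Suc s. 1 - \<zeta> k * x) =
      (\<Prod>k<m. 1 - \<zeta> k * x) * (\<Prod>k\<in>(\<lambda>k. k + m) ` {..<m}. 1 - \<zeta> k * x)"
    by (simp only:) (subst prod.union_disjoint, auto)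
  also have "(\<Prod>k\<in>(\<lambda>k. k + m) ` {..<m}. 1 - \<zeta> k * x) = (\<Prod>k<m. 1 + \<zeta> k * x)"
    by (subst prod.reindex) (simp_all add: shift)
  also have "(\<Prod>k<m. 1 - \<zeta> k * x) * (\<Prod>k<m. 1 + \<zeta> k * x) = (\<Prod>k<m. 1 - cis (2 * pi * real k / 2 ^ s) * x\<^sup>2)"
    unfolding prod.distrib[symmetric] square[symmetric]
    by (intro prod.cong refl) (simp add: algebra_simps power2_eq_square)
  also have "\<dots> = 1 - (x\<^sup>2) ^ (2 ^ s)" unfolding m_def by (rule Suc.IH)
  finally show ?case unfolding \<zeta>_def by (simp add: power_mult)
qed

text \<open>The \<open>m\<close>-th term is the average of \<open>ln |1 - \<zeta>x|\<close> over the \<open>m\<close>-th roots of unity \<open>\<zeta>\<close>, so this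
  is a discrete form of Jensen's formula.\<close>

lemma tendsto_ln_norm_one_minus_power:
  fixes x :: complex
  assumes "cmod x \<noteq> 1"
  shows "(\<lambda>m. ln (cmod (1 - x ^ m)) / real m) \<longlonglongrightarrow> max 0 (ln (cmod x))"
proof -
  have small: "(\<lambda>m. ln (cmod (1 - y ^ m)) / real m) \<longlonglongrightarrow> 0" if "cmod y < 1" for y :: complex
  proof -
    have "(\<lambda>m. cmod (1 - y ^ m)) \<longlonglongrightarrow> cmod (1 - 0)"
      using that by (intro tendsto_intros LIMSEQ_power_zero)
    hence "(\<lambda>m. ln (cmod (1 - y ^ m))) \<longlonglongrightarrow> ln 1" by (intro tendsto_ln) simp_all
    from tendsto_mult[OF this lim_inverse_n] show ?thesis by (simp add: divide_inverse)
  qed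
  show ?thesis
  proof (cases "cmod x < 1")
    case True
    hence "ln (cmod x) \<le> 0" by (cases "x = 0") auto
    thus ?thesis using small[OF True] by (simp add: max_def)
  next
    case False
    hence x: "cmod x > 1" using assms by simp
    hence x0: "x \<noteq> 0" by auto
    have y: "cmod (1 / x) < 1" using x x0 by (simp add: norm_divide divide_less_eq)
    \<comment> \<open>Outside the unit disc, factoring out \<open>x ^ m\<close> reduces to
      \<open>1 / x\<close> and leaves the summand \<open>ln (cmod x)\<close>.\<close>
    have "(\<lambda>m. ln (cmod x) + ln (cmod (1 - (1 / x) ^ m)) / real m) \<longlonglongrightarrow> ln (cmod x) + 0"
      by (intro tendsto_intros small y)
    moreover have "\<forall>\<^sub>F m in sequentially. ln (cmod x) + ln (cmod (1 - (1 / x) ^ m)) / real m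
      = ln (cmod (1 - x ^ m)) / real m"
      using eventually_gt_at_top[of 0]
    proof eventually_elim
      case (elim m)
      have "cmod ((1 / x) ^ m) < 1" using y elim by (simp add: norm_power power_less_one_iff)
      hence "(1 / x) ^ m \<noteq> 1" by auto
      moreover have "1 - x ^ m = - (x ^ m * (1 - (1 / x) ^ m))"
        using x0 by (simp add: field_simps power_divide)
      hence "cmod (1 - x ^ m) = cmod x ^ m * cmod (1 - (1 / x) ^ m)"
        by (metis norm_minus_cancel norm_mult norm_power)
      ultimately have "ln (cmod (1 - x ^ m)) = real m * ln (cmod x) + ln (cmod (1 - (1 / x) ^ m))"
        using x0 by (simp add: ln_mult ln_realpow)
      thus ?case using elim by (simp add: field_simps)
    qed
    ultimately have "(\<lambda>m. ln (cmod (1 - x ^ m)) / real m) \<longlonglongrightarrow> ln (cmod x) + 0"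
      by (rule Lim_transform_eventually)
    thus ?thesis using x by (simp add: max_def)
  qed
qed

section \<open>The plank theorem for finitely many vectors\<close>

text \<open>Along the line \<open>z + t *\<^sub>C v j\<close> each orthogonality condition excludes
  at most one \<open>t\<close>. The result makes the domain of the logarithmic sum in
  \<open>complex_plank\<close> nonempty.\<close>

lemma exists_nonorthogonal:
  fixes v :: "'i \<Rightarrow> 'a::complex_inner"
  assumes "finite I" "\<And>i. i \<in> I \<Longrightarrow> v i \<noteq> 0"
  shows "\<exists>z. \<forall>i\<in>I. cinner (v i) z \<noteq> 0"
  using assms
proof (induction I rule: finite_induct)
  case (insert j I)
  then obtain z where z: "\<forall>i\<in>I. cinner (v i) z \<noteq> 0" by blast
  define B where "B = (\<Union>i\<in>insert j I. {t. cinner (v i) z + t * cinner (v i) (v j) = 0})"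
  have "finite {t. cinner (v i) z + t * cinner (v i) (v j) = 0}" if "i \<in> insert j I" for i
  proof (cases "cinner (v i) (v j) = 0")
    case True
    hence "cinner (v i) z \<noteq> 0"
      using that z insert.prems cinner_eq_zero_iff by blast
    thus ?thesis using True by simp
  next
    case False
    hence "{t. cinner (v i) z + t * cinner (v i) (v j) = 0} \<subseteq> {- cinner (v i) z / cinner (v i) (v j)}"
      by (auto simp: field_simps add_eq_0_iff)
    thus ?thesis by (rule finite_subset) simp
  qed
  hence "finite B" unfolding B_def using insert.hyps by blast
  then obtain t where "t \<notin> B" using ex_new_if_finite infinite_UNIV_char_0 by blast
  hence "\<forall>i\<in>insert j I. cinner (v i) (z + t *\<^sub>C v j) \<noteq> 0"
    unfolding B_def by (auto simp: cinner_add_right cinner_scaleC_right)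
  thus ?case by blast
qed simp

text \<open>The second condition on \<open>r\<close> keeps every factor nonzero on the whole circle
  of competitors, so all of them are admissible in \<open>max\<close> and the limit of the averages
  exists.\<close>

lemma plank_near_maximum:
  fixes v :: "'i \<Rightarrow> 'a::complex_inner"
  assumes I: "finite I" "j \<in> I" and p: "\<And>i. i \<in> I \<Longrightarrow> 0 \<le> p i" "sum p I \<le> 1"
    and z: "norm z = 1" "\<And>i. i \<in> I \<Longrightarrow> cinner (v i) z \<noteq> 0"
    and max: "\<And>w. (\<And>i. i \<in> I \<Longrightarrow> cinner (v i) w \<noteq> 0) \<Longrightarrow>
      (\<Sum>i\<in>I. p i * ln (cmod (cinner (v i) w) / norm w)) \<le> (\<Sum>i\<in>I. p i * ln (cmod (cinner (v i) z))) + \<epsilon>"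
    and r: "r > 0" "\<And>i. i \<in> I \<Longrightarrow> r * cmod (cinner (v i) (v j)) \<noteq> cmod (cinner (v i) z)"
  shows "p j * ln (r * (norm (v j))\<^sup>2 / cmod (cinner (v j) z)) \<le> \<epsilon> + r\<^sup>2 * (norm (v j))\<^sup>2 / 2"
proof -
  \<comment> \<open>Moving from \<open>z\<close> to \<open>z + (r * \<zeta>) *\<^sub>C v j\<close>
    multiplies the \<open>i\<close>-th factor by \<open>1 - \<zeta> * x i\<close>.\<close>
  define x where "x i = - (of_real r * cinner (v i) (v j) / cinner (v i) z)" for i
  have x1: "cmod (x i) \<noteq> 1" if "i \<in> I" for i
    using r z(2)[OF that] r(2)[OF that] unfolding x_def by (simp add: norm_mult norm_divide field_simps)
  have avg: "(\<Sum>i\<in>I. p i * (ln (cmod (1 - x i ^ (2 ^ s))) / real (2 ^ s))) \<le> \<epsilon> + r\<^sup>2 * (norm (v j))\<^sup>2 / 2"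
    if s: "s > 0" for s
  proof -
    define m :: nat where "m = 2 ^ s"
    have m: "m > 1" unfolding m_def using s by (intro one_less_power) simp_all
    define \<zeta> where "\<zeta> k = cis (2 * pi * real k / real m)" for k
    define w where "w k = z + (of_real r * \<zeta> k) *\<^sub>C v j" for k
    have \<zeta>: "cmod (\<zeta> k) = 1" for k unfolding \<zeta>_def by simp
    \<comment> \<open>This needs \<open>m > 1\<close>, hence \<open>s > 0\<close>; it cancels the
      first-order terms when the squared norms of the \<open>w k\<close> are averaged.\<close>
    have sum0: "(\<Sum>k<m. \<zeta> k) = 0"
      using sum.reindex_bij_betw[OF Complex.bij_betw_roots_unity[of m], of "\<lambda>z. z"] sum_roots_unity[OF m] m
      unfolding \<zeta>_def by simp
    have nz: "1 - \<zeta> k * x i \<noteq> 0" if "i \<in> I" for k i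
      using x1[OF that] \<zeta>[of k] by (metis eq_iff_diff_eq_0 mult_1 norm_mult norm_one)
    have cw: "cinner (v i) (w k) = cinner (v i) z * (1 - \<zeta> k * x i)" if "i \<in> I" for k i
      unfolding w_def x_def using z(2)[OF that]
      by (simp add: cinner_add_right cinner_scaleC_right field_simps)
    have cnz: "cinner (v i) (w k) \<noteq> 0" if "i \<in> I" for k i
      unfolding cw[OF that] using nz[OF that] z(2)[OF that] by simp
    have wnz: "w k \<noteq> 0" for k using cnz[OF I(2)] cinner_zero_right by metis
    have each: "(\<Sum>i\<in>I. p i * ln (cmod (1 - \<zeta> k * x i))) \<le> \<epsilon> + sum p I * (((norm (w k))\<^sup>2 - 1) / 2)" for k
    proof -
      have "(\<Sum>i\<in>I. p i * ln (cmod (cinner (v i) (w k)) / norm (w k))) =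
        (\<Sum>i\<in>I. p i * ln (cmod (cinner (v i) z))) + (\<Sum>i\<in>I. p i * ln (cmod (1 - \<zeta> k * x i)))
         - sum p I * ln (norm (w k))"
        unfolding sum_distrib_right sum.distrib[symmetric] sum_subtractf[symmetric]
        using nz z(2) wnz
        by (intro sum.cong refl) (simp add: cw norm_mult ln_div ln_mult distrib_left right_diff_distrib[of "p _"])
      with max[of "w k"] cnz have "(\<Sum>i\<in>I. p i * ln (cmod (1 - \<zeta> k * x i))) \<le> \<epsilon> + sum p I * ln (norm (w k))"
        by fastforce
      moreover have "2 * ln (norm (w k)) \<le> (norm (w k))\<^sup>2 - 1"
        using ln_le_minus_one[of "(norm (w k))\<^sup>2"] wnz by (simp add: ln_realpow)
      hence "sum p I * ln (norm (w k)) \<le> sum p I * (((norm (w k))\<^sup>2 - 1) / 2)"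
        using p(1) by (intro mult_left_mono sum_nonneg) auto
      ultimately show ?thesis by linarith
    qed
    have "(\<Sum>k<m. (norm (w k))\<^sup>2 - 1) = 2 * Re (of_real r * (\<Sum>k<m. \<zeta> k) * cinner z (v j)) + real m * (r\<^sup>2 * (norm (v j))\<^sup>2)"
      unfolding w_def norm_add_scaleC_square
      by (simp add: z(1) norm_mult \<zeta> sum.distrib sum_distrib_left sum_distrib_right mult_ac)
    hence norms: "(\<Sum>k<m. (norm (w k))\<^sup>2 - 1) = real m * (r\<^sup>2 * (norm (v j))\<^sup>2)"
      by (simp add: sum0)
    have "(\<Sum>k<m. ln (cmod (1 - \<zeta> k * x i))) = ln (cmod (1 - x i ^ m))" if "i \<in> I" for i
    proof -
      have "1 - x i ^ m = (\<Prod>k<m. 1 - \<zeta> k * x i)"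
        using prod_roots_of_unity[of s "x i"] unfolding m_def \<zeta>_def by simp
      thus ?thesis using nz[OF that] by (simp add: prod_norm[symmetric] ln_prod)
    qed
    hence "(\<Sum>i\<in>I. p i * ln (cmod (1 - x i ^ m))) = (\<Sum>i\<in>I. p i * (\<Sum>k<m. ln (cmod (1 - \<zeta> k * x i))))"
      by simp
    also have "\<dots> = (\<Sum>k<m. \<Sum>i\<in>I. p i * ln (cmod (1 - \<zeta> k * x i)))"
      unfolding sum_distrib_left by (rule sum.swap)
    also have "\<dots> \<le> (\<Sum>k<m. \<epsilon> + sum p I * (((norm (w k))\<^sup>2 - 1) / 2))"
      by (intro sum_mono each)
    also have "\<dots> = real m * \<epsilon> + sum p I * ((\<Sum>k<m. (norm (w k))\<^sup>2 - 1) / 2)"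
      by (simp only: sum.distrib sum_distrib_left[symmetric] sum_divide_distrib[symmetric]) simp
    also have "\<dots> \<le> real m * \<epsilon> + 1 * (real m * (r\<^sup>2 * (norm (v j))\<^sup>2) / 2)"
      unfolding norms using p(2) by (intro add_left_mono mult_right_mono) auto
    finally have "(\<Sum>i\<in>I. p i * ln (cmod (1 - x i ^ m))) / real m \<le> \<epsilon> + r\<^sup>2 * (norm (v j))\<^sup>2 / 2"
      using m by (simp add: field_simps)
    thus ?thesis unfolding m_def by (simp add: sum_divide_distrib)
  qed
  have two: "filterlim (\<lambda>s. 2 ^ s :: nat) sequentially sequentially"
    by (rule filterlim_subseq) (simp add: strict_mono_def)
  have "(\<lambda>s. \<Sum>i\<in>I. p i * (ln (cmod (1 - x i ^ (2 ^ s))) / real (2 ^ s)))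
      \<longlonglongrightarrow> (\<Sum>i\<in>I. p i * max 0 (ln (cmod (x i))))"
    using x1 by (intro tendsto_sum tendsto_mult tendsto_const
        filterlim_compose[OF tendsto_ln_norm_one_minus_power two]) auto
  hence "(\<Sum>i\<in>I. p i * max 0 (ln (cmod (x i)))) \<le> \<epsilon> + r\<^sup>2 * (norm (v j))\<^sup>2 / 2"
    by (rule LIMSEQ_le_const2) (use avg in \<open>auto intro!: exI[of _ 1]\<close>)
  moreover have "p j * max 0 (ln (cmod (x j))) \<le> (\<Sum>i\<in>I. p i * max 0 (ln (cmod (x i))))"
    using I p(1) by (intro member_le_sum) auto
  moreover have "p j * ln (cmod (x j)) \<le> p j * max 0 (ln (cmod (x j)))"
    using p(1) I by (intro mult_left_mono) auto
  moreover have "cmod (x j) = r * (norm (v j))\<^sup>2 / cmod (cinner (v j) z)"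
    unfolding x_def cinner_self using r by (simp add: norm_mult norm_divide norm_power)
  ultimately show ?thesis by simp
qed

text \<open>One near-maximiser \<open>z\<close> serves every \<open>j\<close>, because the direction
  \<open>v j\<close> and the radius are chosen only afterwards. In the constant,
  \<open>exp 1\<close> comes from bounding a logarithm by 1, and 2 from the freedom left to the
  radius.\<close>

lemma complex_plank:
  fixes v :: "'i \<Rightarrow> 'a::complex_inner"
  assumes I: "finite I" and v: "\<And>i. i \<in> I \<Longrightarrow> v i \<noteq> 0"
    and p: "\<And>i. i \<in> I \<Longrightarrow> 0 < p i" "sum p I \<le> 1"
  shows "\<exists>z. norm z \<le> 1 \<and> (\<forall>i\<in>I. sqrt (p i) * norm (v i) / (2 * exp 1) \<le> cmod (cinner (v i) z))"
proof (cases "I = {}")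
  case True
  thus ?thesis by (intro exI[of _ 0]) simp
next
  case False
  define A where "A = {w. \<forall>i\<in>I. cinner (v i) w \<noteq> 0}"
  define \<Phi> where "\<Phi> w = (\<Sum>i\<in>I. p i * ln (cmod (cinner (v i) w) / norm w))" for w
  have A0: "w \<noteq> 0" if "w \<in> A" for w using that False unfolding A_def by auto
  have "\<Phi> w \<le> (\<Sum>i\<in>I. p i * ln (norm (v i)))" if "w \<in> A" for w
    unfolding \<Phi>_def
  proof (intro sum_mono mult_left_mono)
    fix i assume i: "i \<in> I"
    have "cmod (cinner (v i) w) / norm w \<le> norm (v i)"
      using norm_cinner_le[of "v i" w] A0[OF that] by (simp add: field_simps)
    thus "ln (cmod (cinner (v i) w) / norm w) \<le> ln (norm (v i))"
      using that i A0[OF that] unfolding A_def by (intro ln_mono) auto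
  qed (use p in \<open>auto intro: less_imp_le\<close>)
  hence bdd: "bdd_above (\<Phi> ` A)" by (rule bdd_aboveI2)
  have "A \<noteq> {}" using exists_nonorthogonal[of I v] I v unfolding A_def by blast
  \<comment> \<open>With this tolerance the error is at most \<open>p j / 2\<close> for every
    \<open>j\<close>; the cost of the norm is at most another \<open>p j / 2\<close>, so dividing by
    \<open>p j\<close> bounds the logarithm by 1.\<close>
  define \<epsilon> where "\<epsilon> = Min (p ` I) / 2"
  have "\<epsilon> > 0" unfolding \<epsilon>_def using I False p by simp
  have \<epsilon>: "\<epsilon> \<le> p i / 2" if "i \<in> I" for i unfolding \<epsilon>_def using I that by simp
  obtain z' where z': "z' \<in> A" "(SUP w\<in>A. \<Phi> w) - \<epsilon> < \<Phi> z'"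
    using less_cSUP_iff[OF \<open>A \<noteq> {}\<close> bdd, of "(SUP w\<in>A. \<Phi> w) - \<epsilon>"] \<open>\<epsilon> > 0\<close> by auto
  define z where "z = (1 / norm z') *\<^sub>R z'"
  have nz: "norm z = 1" using A0[OF z'(1)] unfolding z_def by simp
  have zi: "cmod (cinner (v i) z) = cmod (cinner (v i) z') / norm z'" for i
    unfolding z_def cinner_scaleR_right by (simp add: norm_mult norm_divide)
  have z0: "cinner (v i) z \<noteq> 0" if "i \<in> I" for i
    using z'(1) that A0[OF z'(1)] unfolding z_def cinner_scaleR_right A_def by simp
  have max: "\<Phi> w \<le> (\<Sum>i\<in>I. p i * ln (cmod (cinner (v i) z))) + \<epsilon>" if "w \<in> A" for w
    using cSUP_upper[OF that bdd] z'(2) unfolding zi \<Phi>_def by linarith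
  have "sqrt (p j) * norm (v j) / (2 * exp 1) \<le> cmod (cinner (v j) z)" if j: "j \<in> I" for j
  proof -
    define q where "q = sqrt (p j) / norm (v j)"
    have q: "q > 0" unfolding q_def using p j v by simp
    \<comment> \<open>These finitely many radii are forbidden, and the interval from
      \<open>q / 2\<close> to \<open>q\<close> leaves room to avoid them. An \<open>i\<close> with
      \<open>cinner (v i) (v j) = 0\<close> contributes the default quotient 0, harmless since no
      positive radius is bad for it.\<close>
    define R where "R = (\<lambda>i. cmod (cinner (v i) z) / cmod (cinner (v i) (v j))) ` I"
    have "infinite ({q / 2<..<q} - R)" using q I unfolding R_def by (intro Diff_infinite_finite) auto
    then obtain r where "r \<in> {q / 2<..<q} - R" using infinite_imp_nonempty by blast
    hence r: "q / 2 < r" "r < q" "r \<notin> R" by auto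
    have r0: "r > 0" using r q by linarith
    have "r * cmod (cinner (v i) (v j)) \<noteq> cmod (cinner (v i) z)" if "i \<in> I" for i
    proof
      assume eq: "r * cmod (cinner (v i) (v j)) = cmod (cinner (v i) z)"
      hence "cmod (cinner (v i) (v j)) \<noteq> 0" using z0[OF that] by auto
      hence "r = cmod (cinner (v i) z) / cmod (cinner (v i) (v j))"
        using eq by (simp add: field_simps)
      thus False using r(3) that unfolding R_def by blast
    qed
    hence "p j * ln (r * (norm (v j))\<^sup>2 / cmod (cinner (v j) z)) \<le> \<epsilon> + r\<^sup>2 * (norm (v j))\<^sup>2 / 2"
      using I j p nz z0 max r0
      by (intro plank_near_maximum[of I]) (auto simp: A_def \<Phi>_def less_imp_le)
    also have "r\<^sup>2 * (norm (v j))\<^sup>2 \<le> q\<^sup>2 * (norm (v j))\<^sup>2"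
      using r r0 by (intro mult_right_mono power_mono) auto
    also have "q\<^sup>2 * (norm (v j))\<^sup>2 = p j"
      unfolding q_def using p(1)[OF j] v[OF j] by (simp add: power_divide)
    finally have "p j * ln (r * (norm (v j))\<^sup>2 / cmod (cinner (v j) z)) \<le> p j * 1"
      using \<epsilon>[OF j] by simp
    hence "ln (r * (norm (v j))\<^sup>2 / cmod (cinner (v j) z)) \<le> 1"
      using p(1)[OF j] by (simp only: mult_le_cancel_left_pos)
    hence "r * (norm (v j))\<^sup>2 / cmod (cinner (v j) z) \<le> exp 1"
      using r0 v[OF j] z0[OF j] exp_le_cancel_iff[of "ln (r * (norm (v j))\<^sup>2 / cmod (cinner (v j) z))" 1] by simp
    hence "r * (norm (v j))\<^sup>2 / exp 1 \<le> cmod (cinner (v j) z)"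
      using z0[OF j] by (simp add: field_simps)
    moreover have "q / 2 * (norm (v j))\<^sup>2 / exp 1 \<le> r * (norm (v j))\<^sup>2 / exp 1"
      using r by (intro divide_right_mono mult_right_mono) auto
    moreover have "q / 2 * (norm (v j))\<^sup>2 / exp 1 = sqrt (p j) * norm (v j) / (2 * exp 1)"
      unfolding q_def using v[OF j] by (simp add: power2_eq_square)
    ultimately show ?thesis by linarith
  qed
  thus ?thesis using nz by (intro exI[of _ z]) auto
qed

section \<open>Passage to infinitely many vectors\<close>

text \<open>Only countably many pairings must converge. They live in a countable product of discs,
  compact and metrizable, which gives the subsequence; a vector realising the limits comes from
  nested closed convex sets of approximate solutions.\<close>

lemma weak_subsequential_limit:
  fixes v z :: "nat \<Rightarrow> 'a::chilbert_space"
  assumes z: "\<And>N. norm (z N) \<le> 1"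
  shows "\<exists>y \<sigma>. strict_mono (\<sigma> :: nat \<Rightarrow> nat) \<and>
    (\<forall>j. (\<lambda>N. cinner (v j) (z (\<sigma> N))) \<longlonglongrightarrow> cinner (v j) y)"
proof -
  define Q where "Q = PiE UNIV (\<lambda>j. cball (0::complex) (norm (v j)))"
  define X where "X N = (\<lambda>j. cinner (v j) (z N))" for N
  have "compactin (product_topology (\<lambda>_. euclidean) UNIV) Q"
    unfolding Q_def compactin_PiE by simp
  hence "compact Q" by (simp add: euclidean_product_topology)
  hence "seq_compact Q" by (simp add: compact_eq_seq_compact_metric)
  moreover have "cmod (cinner (v j) (z N)) \<le> norm (v j)" for j N
    using norm_cinner_le[of "v j" "z N"] mult_left_le[OF z[of N] norm_ge_zero[of "v j"]]
    by linarith
  hence "X N \<in> Q" for N unfolding Q_def X_def by (simp add: PiE_UNIV_domain)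
  ultimately obtain \<alpha> \<sigma> where \<sigma>: "strict_mono (\<sigma> :: nat \<Rightarrow> nat)" and X\<alpha>: "(X \<circ> \<sigma>) \<longlonglongrightarrow> \<alpha>"
    unfolding seq_compact_def by metis
  have "(\<lambda>N. (X \<circ> \<sigma>) N j) \<longlonglongrightarrow> \<alpha> j" for j
    by (rule continuous_on_tendsto_compose[OF continuous_on_product_coordinates X\<alpha>]) simp_all
  hence lim: "(\<lambda>N. cinner (v j) (z (\<sigma> N))) \<longlonglongrightarrow> \<alpha> j" for j
    by (simp add: X_def)
  \<comment> \<open>Finitely many constraints with a positive tolerance are met by
    \<open>z (\<sigma> N)\<close> for large \<open>N\<close>, so each \<open>K m\<close> is
    nonempty.\<close>
  define K where "K m = cball 0 1 \<inter> (\<Inter>j\<le>m. cinner (v j) -` cball (\<alpha> j) (inverse (real (Suc m))))" for m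
  have Kne: "\<exists>y\<in>K m. norm y \<le> 1" for m
  proof -
    have "\<forall>\<^sub>F N in sequentially. \<forall>j\<in>{..m}. dist (cinner (v j) (z (\<sigma> N))) (\<alpha> j) < inverse (real (Suc m))"
      using lim by (intro eventually_ball_finite ballI tendstoD) auto
    then obtain N where "\<forall>j\<in>{..m}. dist (cinner (v j) (z (\<sigma> N))) (\<alpha> j) < inverse (real (Suc m))"
      using eventually_happens'[OF sequentially_bot] by blast
    hence "z (\<sigma> N) \<in> K m" unfolding K_def using z by (auto simp: dist_commute less_imp_le)
    thus ?thesis using z by blast
  qed
  have "\<exists>y. \<forall>m. y \<in> K m"
  proof (rule nested_closed_convex_nonempty[where B = 1])
    show "closed (K m)" for m
      unfolding K_def
      by (intro closed_Int closed_INT ballI closed_cball continuous_closed_vimage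
          bounded_linear.isCont[OF bounded_linear_cinner_right] continuous_ident)
    show "convex (K m)" for m
      unfolding K_def
      by (intro convex_Int convex_INT convex_cball convex_linear_vimage
          bounded_linear.linear[OF bounded_linear_cinner_right])
    show "K n \<subseteq> K m" if "m \<le> n" for m n
    proof -
      have "inverse (real (Suc n)) \<le> inverse (real (Suc m))" using that by (simp add: field_simps)
      thus ?thesis unfolding K_def using that
        by (intro Int_mono INT_anti_mono vimage_mono subset_cball) auto
    qed
  qed (rule Kne)
  then obtain y where y: "\<And>m. y \<in> K m" by blast
  have "cinner (v j) y = \<alpha> j" for j
  proof -
    have "dist (\<alpha> j) (cinner (v j) y) \<le> 0"
    proof (rule LIMSEQ_le_const[OF LIMSEQ_inverse_real_of_nat])
      show "\<exists>N. \<forall>n\<ge>N. dist (\<alpha> j) (cinner (v j) y) \<le> inverse (real (Suc n))"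
        using y unfolding K_def by (intro exI[of _ j]) auto
    qed
    thus ?thesis by simp
  qed
  thus ?thesis using \<sigma> lim by metis
qed

lemma exists_functional_bounded_below:
  fixes v :: "nat \<Rightarrow> 'a::chilbert_space"
  assumes v: "\<And>n. v n \<noteq> 0" and summ: "summable (\<lambda>n. 1 / (norm (v n))\<^sup>2)"
  shows "\<exists>y \<delta>. \<delta> > 0 \<and> (\<forall>n. \<delta> \<le> cmod (cinner (v n) y))"
proof -
  define M where "M = (\<Sum>n. 1 / (norm (v n))\<^sup>2)"
  have M: "M > 0" unfolding M_def using v by (intro suminf_pos summ) simp
  \<comment> \<open>Weights proportional to \<open>1 / (norm (v n))\<^sup>2\<close> make the lower
    bound of the plank theorem the same for all \<open>n\<close>; dividing by \<open>M\<close> keeps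
    the partial sums at most 1.\<close>
  define p where "p n = 1 / (M * (norm (v n))\<^sup>2)" for n
  define \<delta> where "\<delta> = 1 / (sqrt M * (2 * exp 1))"
  have \<delta>: "sqrt (p n) * norm (v n) / (2 * exp 1) = \<delta>" for n
    unfolding p_def \<delta>_def using v[of n] M by (simp add: real_sqrt_divide real_sqrt_mult)
  have "\<exists>z. norm z \<le> 1 \<and> (\<forall>n\<in>{..<N}. sqrt (p n) * norm (v n) / (2 * exp 1) \<le> cmod (cinner (v n) z))" for N
  proof (rule complex_plank)
    have "sum p {..<N} = (\<Sum>n<N. 1 / (norm (v n))\<^sup>2) / M"
      unfolding p_def sum_divide_distrib by (simp add: mult.commute)
    also have "\<dots> \<le> M / M"
      unfolding M_def using M by (intro divide_right_mono sum_le_suminf summ) (auto simp: M_def)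
    finally show "sum p {..<N} \<le> 1" using M by simp
  qed (use v M in \<open>simp_all add: p_def\<close>)
  then obtain z where z: "\<And>N. norm (z N) \<le> 1" "\<And>n N. n < N \<Longrightarrow> \<delta> \<le> cmod (cinner (v n) (z N))"
    unfolding \<delta> by (metis lessThan_iff)
  obtain y \<sigma> where \<sigma>: "strict_mono (\<sigma> :: nat \<Rightarrow> nat)"
    and y: "\<And>j. (\<lambda>N. cinner (v j) (z (\<sigma> N))) \<longlonglongrightarrow> cinner (v j) y"
    using weak_subsequential_limit[of z v] z(1) by blast
  have "\<delta> \<le> cmod (cinner (v n) y)" for n
  proof (rule LIMSEQ_le_const[OF tendsto_norm[OF y]])
    show "\<exists>N. \<forall>m\<ge>N. \<delta> \<le> cmod (cinner (v n) (z (\<sigma> m)))"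
      using z(2) seq_suble[OF \<sigma>] by (meson Suc_le_lessD order_trans)
  qed
  moreover have "\<delta> > 0" unfolding \<delta>_def using M by simp
  ultimately show ?thesis by blast
qed

section \<open>Weak hypercyclicity\<close>

text \<open>For \<open>y \<noteq> 0\<close> the functional \<open>cinner y\<close>, placed at index
  0, is an admissible \<open>L\<close>; evaluation at index 0 is continuous and carries density back
  to the complex plane.\<close>

lemma weakly_hypercyclic_dense:
  fixes T :: "'a::complex_inner \<Rightarrow> 'a"
  assumes "n_weakly_hypercyclic 1 T"
  shows "\<exists>x. \<forall>y. y \<noteq> 0 \<longrightarrow> closure (range (\<lambda>m. cinner y ((T ^^ m) x))) = UNIV"
proof -
  from assms obtain x where x: "\<And>L :: 'a \<Rightarrow> nat \<Rightarrow> complex.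
      \<lbrakk>\<forall>u v. L (u + v) = (\<lambda>i. L u i + L v i); \<forall>c u. L (c *\<^sub>C u) = (\<lambda>i. c * L u i);
       continuous_on UNIV L; range L = Cn 1\<rbrakk> \<Longrightarrow> Cn 1 \<subseteq> closure (range (\<lambda>m. L ((T ^^ m) x)))"
    unfolding n_weakly_hypercyclic_def by blast
  have "closure (range (\<lambda>m. cinner y ((T ^^ m) x))) = UNIV" if y: "y \<noteq> 0" for y
  proof -
    define L :: "'a \<Rightarrow> nat \<Rightarrow> complex" where "L u = (\<lambda>i. if i = 0 then cinner y u else 0)" for u
    have "Cn 1 \<subseteq> range L"
    proof
      fix f assume f: "f \<in> Cn 1"
      have "L ((f 0 / cinner y y) *\<^sub>C y) = f"
        using f y cinner_eq_zero_iff[of y] unfolding L_def Cn_def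
        by (auto simp: fun_eq_iff cinner_scaleC_right)
      thus "f \<in> range L" by (metis rangeI)
    qed
    moreover have "range L \<subseteq> Cn 1" unfolding L_def Cn_def by auto
    moreover have "continuous_on UNIV L"
    proof (rule continuous_on_coordinatewise_then_product)
      show "continuous_on UNIV (\<lambda>u. L u i)" for i
        unfolding L_def
        by (cases "i = 0") (auto intro: bounded_linear.continuous_on[OF bounded_linear_cinner_right] continuous_on_id)
    qed
    ultimately have L: "Cn 1 \<subseteq> closure (range (\<lambda>m. L ((T ^^ m) x)))"
      by (intro x) (auto simp: L_def fun_eq_iff cinner_add_right cinner_scaleC_right)
    have "c \<in> closure (range (\<lambda>m. cinner y ((T ^^ m) x)))" for c
    proof -
      define f :: "nat \<Rightarrow> complex" where "f i = (if i = 0 then c else 0)" for i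
      have "f \<in> closure (range (\<lambda>m. L ((T ^^ m) x)))" using L unfolding f_def Cn_def by auto
      hence "f 0 \<in> (\<lambda>g. g 0) ` closure (range (\<lambda>m. L ((T ^^ m) x)))" by (rule imageI)
      also have "\<dots> \<subseteq> closure (range (\<lambda>m. cinner y ((T ^^ m) x)))"
      proof (rule image_closure_subset)
        show "continuous_on (closure (range (\<lambda>m. L ((T ^^ m) x)))) (\<lambda>g. g 0)"
          by (rule continuous_on_subset[OF continuous_on_product_coordinates]) simp
        show "(\<lambda>g. g 0) ` range (\<lambda>m. L ((T ^^ m) x)) \<subseteq> closure (range (\<lambda>m. cinner y ((T ^^ m) x)))"
          using closure_subset[of "range (\<lambda>m. cinner y ((T ^^ m) x))"] by (auto simp: L_def)
      qed simp
      finally show ?thesis unfolding f_def by simp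
    qed
    thus ?thesis by blast
  qed
  thus ?thesis by blast
qed

section \<open>Growth of orbits and the final contradiction\<close>

lemma summable_inverse_orbit_norm_square:
  fixes T S :: "'a::real_normed_vector \<Rightarrow> 'a"
  assumes comm: "\<And>u. T (S u) = S (T u)"
    and growth: "\<And>u. (norm u)\<^sup>2 + (norm (S u))\<^sup>2 \<le> (norm (T u))\<^sup>2"
    and x: "S (S x) \<noteq> 0"
  shows "summable (\<lambda>n. 1 / (norm ((T ^^ n) x))\<^sup>2)"
proof -
  have comm': "S ((T ^^ n) u) = (T ^^ n) (S u)" for n u
    by (induction n) (simp_all flip: comm)
  have step: "(norm ((T ^^ n) u))\<^sup>2 + (norm ((T ^^ n) (S u)))\<^sup>2 \<le> (norm ((T ^^ Suc n) u))\<^sup>2" for n u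
    using growth[of "(T ^^ n) u"] by (simp add: comm')
  define c where "c = (norm (S (S x)))\<^sup>2"
  have c: "c > 0" using x unfolding c_def by simp
  have 2: "c \<le> (norm ((T ^^ n) (S (S x))))\<^sup>2" for n
  proof (induction n)
    case (Suc n)
    thus ?case using step[of n "S (S x)"] zero_le_power2[of "norm ((T ^^ n) (S (S (S x))))"] by linarith
  qed (simp add: c_def)
  have 1: "real n * c \<le> (norm ((T ^^ n) (S x)))\<^sup>2" for n
  proof (induction n)
    case (Suc n)
    thus ?case using step[of n "S x"] 2[of n] by (simp add: algebra_simps)
  qed simp
  \<comment> \<open>Summing the linear bound \<open>real k * c\<close> over \<open>k < n\<close>
    gives the factor \<open>n * (n - 1) / 2\<close>.\<close>
  have 0: "real n * (real n - 1) / 2 * c \<le> (norm ((T ^^ n) x))\<^sup>2" for n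
  proof (induction n)
    case (Suc n)
    thus ?case using step[of n x] 1[of n] by (simp add: field_simps)
  qed simp
  show ?thesis
  proof (rule summable_comparison_test_ev)
    show "summable (\<lambda>n. 4 / c * inverse (real n ^ 2))"
      by (intro summable_mult inverse_power_summable) simp
    show "\<forall>\<^sub>F n in sequentially. norm (1 / (norm ((T ^^ n) x))\<^sup>2) \<le> 4 / c * inverse (real n ^ 2)"
      using eventually_ge_at_top[of 2]
    proof eventually_elim
      case (elim n)
      \<comment> \<open>For \<open>n \<ge> 2\<close>, \<open>n - 1\<close> is at least
        \<open>n / 2\<close>; hence the constant 4.\<close>
      have "real n ^ 2 / 4 * c \<le> real n * (real n - 1) / 2 * c"
        using elim c by (intro mult_right_mono) (auto simp: power2_eq_square field_simps)
      also note 0[of n]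
      finally have "1 / (norm ((T ^^ n) x))\<^sup>2 \<le> 1 / (real n ^ 2 / 4 * c)"
        using elim c by (intro frac_le) auto
      thus ?case by (simp add: field_simps)
    qed
  qed
qed

theorem theorem1p8:
  fixes T :: "'a::chilbert_space \<Rightarrow> 'a"
  assumes "bounded_clinear_op T"
    and "\<exists>S. bounded_clinear_op S \<and> S \<circ> S \<noteq> (\<lambda>_. 0) \<and> T \<circ> S = S \<circ> T
             \<and> op_le (\<lambda>x. cadjoint S (S x) + x) (\<lambda>x. cadjoint T (T x))"
  shows "\<not> n_weakly_hypercyclic 1 T"
proof
  assume "n_weakly_hypercyclic 1 T"
  then obtain x where x: "\<And>y. y \<noteq> 0 \<Longrightarrow> closure (range (\<lambda>m. cinner y ((T ^^ m) x))) = UNIV"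
    using weakly_hypercyclic_dense by blast
  from assms(2) obtain S where S: "bounded_clinear_op S" and SS: "S \<circ> S \<noteq> (\<lambda>_. 0)"
    and TS: "T \<circ> S = S \<circ> T" and le: "op_le (\<lambda>x. cadjoint S (S x) + x) (\<lambda>x. cadjoint T (T x))"
    by blast
  have comm: "T (S u) = S (T u)" for u using TS by (metis comp_apply)
  have sq: "cinner (cadjoint R (R u)) u = of_real ((norm (R u))\<^sup>2)"
    if "bounded_clinear_op R" for R :: "'a \<Rightarrow> 'a" and u
    by (metis cinner_cadjoint[OF that] cinner_commute cinner_self complex_cnj_complex_of_real)
  have growth: "(norm u)\<^sup>2 + (norm (S u))\<^sup>2 \<le> (norm (T u))\<^sup>2" for u
    using le sq[OF S, of u] sq[OF assms(1), of u] unfolding op_le_def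
    by (auto simp: cinner_diff_left cinner_add_left cinner_self dest!: spec[of _ u] simp del: of_real_power)
  have zero: "R 0 = 0" if "bounded_clinear_op R" for R :: "'a \<Rightarrow> 'a"
    using that unfolding bounded_clinear_op_def clinear_def by (metis add_cancel_right_right)
  have inj: "u = 0" if "T u = 0" for u
    using growth[of u] that by (simp add: sum_power2_le_zero_iff)
  have SSx: "S (S x) \<noteq> 0"
  proof
    assume 0: "S (S x) = 0"
    have orbit: "S (S ((T ^^ m) x)) = 0" for m
      by (induction m) (simp_all add: 0 zero[OF assms(1)] flip: comm)
    obtain u where u: "S (S u) \<noteq> 0" using SS by (auto simp: fun_eq_iff)
    \<comment> \<open>\<open>cinner u y\<close> is the squared norm of \<open>S (S u)\<close>, so
      \<open>y\<close> is nonzero; pairing \<open>y\<close> with the orbit moves two factors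
      \<open>S\<close> onto the orbit, where they give 0.\<close>
    define y where "y = cadjoint S (cadjoint S (S (S u)))"
    have y: "cinner w y = cinner (S (S w)) (S (S u))" for w
      unfolding y_def by (simp add: cinner_cadjoint[OF S])
    hence "cinner u y \<noteq> 0" using u by (simp add: cinner_eq_zero_iff)
    hence "y \<noteq> 0" by auto
    moreover have "cinner y ((T ^^ m) x) = 0" for m
      using y[of "(T ^^ m) x"] cinner_commute[of y "(T ^^ m) x"] by (simp add: orbit)
    ultimately have "closure (range (\<lambda>m::nat. 0::complex)) = UNIV" using x[of y] by simp
    hence "1 \<in> {0::complex}" by simp
    thus False by simp
  qed
  \<comment> \<open>The growth inequality makes \<open>T\<close> injective, so no orbit vector
    vanishes, as the plank argument requires.\<close>
  have "(T ^^ n) x \<noteq> 0" for n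
  proof (induction n)
    case 0
    show ?case using SSx zero[OF S] by auto
  next
    case (Suc n)
    thus ?case using inj by auto
  qed
  then obtain y \<delta> where \<delta>: "\<delta> > 0" "\<And>n. \<delta> \<le> cmod (cinner ((T ^^ n) x) y)"
    using exists_functional_bounded_below[of "\<lambda>n. (T ^^ n) x"]
      summable_inverse_orbit_norm_square[of T S x] comm growth SSx by blast
  have "y \<noteq> 0" using \<delta>(1) \<delta>(2)[of 0] by auto
  hence "0 \<in> closure (range (\<lambda>m. cinner y ((T ^^ m) x)))" using x by simp
  then obtain m where "cmod (cinner y ((T ^^ m) x)) < \<delta>"
    using \<delta>(1) unfolding closure_approachable by auto
  thus False using \<delta>(2)[of m] cinner_commute[of y "(T ^^ m) x"] by simp
qed

end
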